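(* Let $G$ be a finite simple graph and $u\in V(G)$. Then $$\gamma_{gr}(G)-2\le \gamma_{gr}(G-u)\le \gamma_{gr}(G).$$ Moreover, there exist graphs $G$ such that each of the three values $\gamma_{gr}(G)-2$, $\gamma_{gr}(G)-1$, $\gamma_{gr}(G)$ is attained as $\gamma_{gr}(G-u)$ for some vertex $u\in V(G)$ (different vertices realizing different values).
   Context: For a vertex $v$ of a graph $G$, $N[v]$ denotes its closed neighborhood. A sequence $S=(v_1,\ldots,v_k)$ of distinct vertices of $G$ is a legal sequence if $N[v_i]\setminus\bigcup_{j=1}^{i-1}N[v_j]\neq\emptyset$ for every $i$. It is a dominating sequence if moreover $\{v_1,\ldots,v_k\}$ is a dominating set of $G$. The Grundy domination number $\gamma_{gr}(G)$ is the maximum length of a legal dominating sequence of $G$. $G-u$ denotes the graph obtained from $G$ by deleting the vertex $u$ and its incident edges. *)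

theory Defs
  imports "Graph_Theory.Digraph"
begin

text \<open>
  Finite simple graphs are the symmetric, loop-free, multi-arc-free finite digraphs of
  locale \<^locale>\<open>graph\<close>; an undirected edge is a pair of opposite arcs. The graph without
  vertices is allowed, so that deleting the only vertex of a graph is meaningful.
\<close>

definition closed_nbhd :: "('a, 'b) pre_digraph \<Rightarrow> 'a \<Rightarrow> 'a set" where
  "closed_nbhd G v = insert v {w. v \<rightarrow>\<^bsub>G\<^esub> w}"

definition legal_seq :: "('a, 'b) pre_digraph \<Rightarrow> 'a list \<Rightarrow> bool" where
  "legal_seq G S \<longleftrightarrow> distinct S \<and> set S \<subseteq> verts G \<and>
     (\<forall>i < length S. closed_nbhd G (S ! i) - (\<Union>j < i. closed_nbhd G (S ! j)) \<noteq> {})"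

definition dominating_set :: "('a, 'b) pre_digraph \<Rightarrow> 'a set \<Rightarrow> bool" where
  "dominating_set G D \<longleftrightarrow> D \<subseteq> verts G \<and> (\<forall>v \<in> verts G - D. \<exists>d \<in> D. d \<rightarrow>\<^bsub>G\<^esub> v)"

definition dominating_seq :: "('a, 'b) pre_digraph \<Rightarrow> 'a list \<Rightarrow> bool" where
  "dominating_seq G S \<longleftrightarrow> legal_seq G S \<and> dominating_set G (set S)"

text \<open>
  For a finite graph the set below is finite and nonempty, so its maximum is attained;
  the empty sequence gives the value 0 for the graph without vertices.
\<close>

definition grundy_dom :: "('a, 'b) pre_digraph \<Rightarrow> nat" where
  "grundy_dom G = Max {length S | S. dominating_seq G S}"

end

theory Submission
  imports Defs
begin

text \<open>
  Every legal sequence can be prolonged to a dominating one, so the Grundy domination number is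
  the maximal length of a legal sequence. A legal sequence of \<open>G - u\<close> is legal in \<open>G\<close>. Conversely,
  a legal sequence of \<open>G\<close> becomes one of \<open>G - u\<close> after removing \<open>u\<close> and the at most one vertex
  that newly dominates only \<open>u\<close>.

  The three values occur for a triangle \<open>0, 1, 2\<close> with the path \<open>2, 3, 4, 5\<close> attached, on deleting
  \<open>3\<close>, \<open>5\<close> and \<open>0\<close>. The upper bounds there come from edge clique covers: if the \<open>i\<close>-th vertex of
  a legal sequence newly dominates \<open>w\<^sub>i\<close>, no clique contains two of the pairs \<open>(v\<^sub>i, w\<^sub>i)\<close>.
\<close>

section \<open>Legal sequences and the Grundy domination number as their maximal length\<close>

lemma legal_seq_Nil [simp]: "legal_seq G []"
  by (simp add: legal_seq_def)

text \<open>Replaces the indexed condition by one on the last entry only, which is what the reverse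
  inductions below need.\<close>

lemma legal_seq_snoc:
  "legal_seq G (S @ [v]) \<longleftrightarrow>
     legal_seq G S \<and> v \<in> verts G \<and> closed_nbhd G v - (\<Union>x\<in>set S. closed_nbhd G x) \<noteq> {}"
proof -
  let ?new = "\<lambda>S i. closed_nbhd G (S ! i) - (\<Union>j<i. closed_nbhd G (S ! j))"
  have old: "?new (S @ [v]) i = ?new S i" if "i < length S" for i
    using that by (auto simp: nth_append)
  have "(\<Union>j<length S. closed_nbhd G ((S @ [v]) ! j)) = (\<Union>x\<in>set S. closed_nbhd G x)"
    by (force simp: nth_append set_conv_nth)
  then have last: "?new (S @ [v]) (length S) = closed_nbhd G v - (\<Union>x\<in>set S. closed_nbhd G x)"
    by simp
  have "(\<forall>i<length (S @ [v]). ?new (S @ [v]) i \<noteq> {}) \<longleftrightarrow>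
      (\<forall>i<length S. ?new S i \<noteq> {}) \<and> closed_nbhd G v - (\<Union>x\<in>set S. closed_nbhd G x) \<noteq> {}"
    unfolding length_append_singleton All_less_Suc last using old by metis
  \<comment> \<open>A repeated vertex newly dominates nothing, so distinctness comes for
    free.\<close>
  moreover have "v \<notin> set S" if "closed_nbhd G v - (\<Union>x\<in>set S. closed_nbhd G x) \<noteq> {}"
    using that by auto
  ultimately show ?thesis
    unfolding legal_seq_def distinct_append set_append by auto
qed

lemma (in fin_digraph) finite_dominating_lengths: "finite {length S | S. dominating_seq G S}"
proof (rule finite_subset)
  show "{length S | S. dominating_seq G S} \<subseteq> {..card (verts G)}"
    by (auto simp: dominating_seq_def legal_seq_def)
      (metis card_mono distinct_card finite_verts)
qed simp

lemma (in fin_digraph) legal_seq_extend: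
  assumes "legal_seq G S"
  obtains T where "dominating_seq G (S @ T)"
proof -
  have "\<exists>T. dominating_seq G (S @ T)"
    using assms
  proof (induction "card (verts G) - length S" arbitrary: S rule: less_induct)
    case less
    show ?case
    proof (cases "dominating_set G (set S)")
      case True
      then have "dominating_seq G (S @ [])"
        using less.prems by (simp add: dominating_seq_def)
      then show ?thesis ..
    next
      case False
      have S: "distinct S" "set S \<subseteq> verts G"
        using less.prems by (auto simp: legal_seq_def)
      then obtain v where v: "v \<in> verts G" "v \<notin> set S" "\<And>d. d \<in> set S \<Longrightarrow> \<not> d \<rightarrow>\<^bsub>G\<^esub> v"
        using False by (auto simp: dominating_set_def)
      \<comment> \<open>An undominated vertex can always be appended, because it newly dominates
        itself. Distinctness bounds the length by the number of vertices, so this process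
        stops.\<close>
      then have "v \<in> closed_nbhd G v - (\<Union>x\<in>set S. closed_nbhd G x)"
        by (auto simp: closed_nbhd_def)
      then have legal: "legal_seq G (S @ [v])"
        using less.prems v by (auto simp: legal_seq_snoc)
      have "set S \<subset> verts G"
        using S v by auto
      then have "length S < card (verts G)"
        using S by (metis distinct_card finite_verts psubset_card_mono)
      then show ?thesis
        using less.hyps[OF _ legal] by fastforce
    qed
  qed
  then show ?thesis
    using that by blast
qed

lemma (in fin_digraph) length_le_grundy_dom:
  assumes "legal_seq G S"
  shows "length S \<le> grundy_dom G"
proof -
  obtain T where "dominating_seq G (S @ T)"
    using legal_seq_extend[OF assms] .
  then have "length (S @ T) \<le> grundy_dom G"
    unfolding grundy_dom_def by (intro Max_ge[OF finite_dominating_lengths]) blast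
  then show ?thesis
    by simp
qed

lemma (in fin_digraph) grundy_dom_attained:
  obtains S where "legal_seq G S" "length S = grundy_dom G"
proof -
  obtain T where "dominating_seq G T"
    using legal_seq_extend[OF legal_seq_Nil] by auto
  then have "grundy_dom G \<in> {length S | S. dominating_seq G S}"
    unfolding grundy_dom_def by (intro Max_in[OF finite_dominating_lengths]) blast
  then show ?thesis
    using that by (auto simp: dominating_seq_def)
qed

section \<open>Effect of deleting a vertex on legal sequences\<close>

lemma closed_nbhd_del_vert:
  "v \<noteq> u \<Longrightarrow> closed_nbhd (pre_digraph.del_vert G u) v = closed_nbhd G v - {u}"
  by (auto simp: closed_nbhd_def arcs_ends_def arc_to_ends_def pre_digraph.verts_del_vert
      pre_digraph.arcs_del_vert pre_digraph.tail_del_vert pre_digraph.head_del_vert image_iff)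

text \<open>Passing back to \<open>G\<close> can only add \<open>u\<close> to the neighborhoods of
  the entries. A vertex newly dominated in \<open>G - u\<close> differs from \<open>u\<close>, so it
  is still new in \<open>G\<close>.\<close>

lemma legal_seq_del_vertD:
  assumes "legal_seq (pre_digraph.del_vert G u) S"
  shows "legal_seq G S"
  using assms
proof (induction S rule: rev_induct)
  case (snoc v S)
  have "v \<noteq> u" and "\<And>x. x \<in> set S \<Longrightarrow> x \<noteq> u"
    using snoc.prems by (auto simp: legal_seq_def pre_digraph.verts_del_vert)
  then show ?case
    using snoc by (auto simp: legal_seq_snoc closed_nbhd_del_vert pre_digraph.verts_del_vert)
qed simp

text \<open>The two indicators account for the two possible losses: the entry \<open>u\<close>
  itself, and the entry at which \<open>u\<close> becomes dominated. Each can change from 0 to 1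
  only once along the sequence. Keeping them separate, instead of the bound 2, makes the induction
  go through.\<close>

lemma legal_seq_del_vert:
  assumes "legal_seq G S"
  shows "\<exists>T. legal_seq (pre_digraph.del_vert G u) T \<and> set T \<subseteq> set S \<and>
    length S \<le> length T + of_bool (u \<in> set S) + of_bool (u \<in> (\<Union>x\<in>set S. closed_nbhd G x))"
  using assms
proof (induction S rule: rev_induct)
  case (snoc v S)
  let ?G' = "pre_digraph.del_vert G u" and ?N = "\<Union>x\<in>set S. closed_nbhd G x"
  obtain w where w: "w \<in> closed_nbhd G v" "w \<notin> ?N" and v: "v \<in> verts G"
    and "legal_seq G S"
    using snoc.prems by (auto simp: legal_seq_snoc)
  then obtain T where T: "legal_seq ?G' T" "set T \<subseteq> set S"
    "length S \<le> length T + of_bool (u \<in> set S) + of_bool (u \<in> ?N)"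
    using snoc.IH by blast
  have "v \<notin> set S"
    using snoc.prems by (auto simp: legal_seq_def)
  consider "v = u" | "v \<noteq> u" "w = u" | "v \<noteq> u" "w \<noteq> u"
    by blast
  then show ?case
  proof cases
    \<comment> \<open>Dropping \<open>v\<close> is paid for by the first indicator, which was 0
      since \<open>v\<close> is not in \<open>S\<close>.\<close>
    case 1
    then show ?thesis
      using T \<open>v \<notin> set S\<close> by (intro exI[of _ T]) (auto simp: of_bool_def split: if_splits)
  next
    \<comment> \<open>Here \<open>u\<close> was undominated before \<open>v\<close>, so the second
      indicator becomes 1 and pays.\<close>
    case 2
    then show ?thesis
      using T w by (intro exI[of _ T]) (auto simp: of_bool_def split: if_splits)
  next
    case 3
    have "u \<notin> set T"
      using T(1) by (auto simp: legal_seq_def pre_digraph.verts_del_vert)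
    \<comment> \<open>\<open>T\<close> has fewer entries and smaller neighborhoods than
      \<open>S\<close>, so \<open>w\<close> is still new.\<close>
    then have "w \<notin> (\<Union>x\<in>set T. closed_nbhd ?G' x)"
      using w T(2) by (auto simp: closed_nbhd_del_vert) (metis DiffD1 closed_nbhd_del_vert subsetD)
    moreover have "w \<in> closed_nbhd ?G' v"
      using w 3 by (simp add: closed_nbhd_del_vert)
    ultimately have "legal_seq ?G' (T @ [v])"
      using T(1) v 3 by (auto simp: legal_seq_snoc pre_digraph.verts_del_vert)
    then show ?thesis
      using T by (intro exI[of _ "T @ [v]"]) (auto simp: of_bool_def split: if_splits)
  qed
qed simp

lemma (in fin_digraph) grundy_dom_del_vert_bounds:
  "grundy_dom (del_vert u) \<le> grundy_dom G" "grundy_dom G \<le> grundy_dom (del_vert u) + 2"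
proof -
  interpret del: fin_digraph "del_vert u"
    by (rule fin_digraph_del_vert)
  show "grundy_dom (del_vert u) \<le> grundy_dom G"
    using del.grundy_dom_attained legal_seq_del_vertD length_le_grundy_dom by metis
  obtain S where "legal_seq G S" and S: "length S = grundy_dom G"
    by (rule grundy_dom_attained)
  then obtain T where "legal_seq (del_vert u) T" and "length S \<le> length T + 2"
    using legal_seq_del_vert[of G S u] by (fastforce simp: of_bool_def split: if_splits)
  then show "grundy_dom G \<le> grundy_dom (del_vert u) + 2"
    using del.length_le_grundy_dom S by fastforce
qed

section \<open>Upper bounds from edge clique covers\<close>

lemma legal_seq_length_le_clique_cover:
  assumes "finite C"
    and clique: "\<And>c x. c \<in> C \<Longrightarrow> x \<in> c \<Longrightarrow> c \<subseteq> closed_nbhd G x"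
    and cover: "\<And>v w. v \<in> verts G \<Longrightarrow> w \<in> closed_nbhd G v \<Longrightarrow> \<exists>c\<in>C. v \<in> c \<and> w \<in> c"
    and "legal_seq G S"
  shows "length S \<le> card C"
proof -
  \<comment> \<open>\<open>D\<close> collects one clique per entry. That each of them meets
    \<open>S\<close> is carried along to show that the next clique is a different one: a clique
    containing an earlier \<open>x\<close> lies inside its closed neighborhood and so cannot contain
    the new \<open>w\<close>.\<close>
  have "\<exists>D\<subseteq>C. card D = length S \<and> (\<forall>c\<in>D. \<exists>x\<in>set S. x \<in> c)"
    using \<open>legal_seq G S\<close>
  proof (induction S rule: rev_induct)
    case (snoc v S)
    then obtain D where D: "D \<subseteq> C" "card D = length S" "\<forall>c\<in>D. \<exists>x\<in>set S. x \<in> c"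
      by (auto simp: legal_seq_snoc)
    obtain w where w: "w \<in> closed_nbhd G v" "w \<notin> (\<Union>x\<in>set S. closed_nbhd G x)" "v \<in> verts G"
      using snoc.prems by (auto simp: legal_seq_snoc)
    then obtain c where c: "c \<in> C" "v \<in> c" "w \<in> c"
      using cover by blast
    have "c \<notin> D"
    proof
      assume "c \<in> D"
      then obtain x where "x \<in> set S" "x \<in> c"
        using D(3) by blast
      then have "w \<in> closed_nbhd G x"
        using clique c(1,3) by blast
      then show False
        using w(2) \<open>x \<in> set S\<close> by blast
    qed
    moreover have "finite D"
      using D(1) \<open>finite C\<close> by (rule finite_subset)
    ultimately show ?case
      using D c by (intro exI[of _ "insert c D"]) auto
  qed simp
  then show ?thesis
    using card_mono[OF \<open>finite C\<close>] by metis
qed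

text \<open>Certifies a value from both sides: the sequence from below, the clique cover from
  above.\<close>

lemma (in fin_digraph) grundy_dom_eqI:
  assumes "legal_seq G S"
    and "card C = n"
    and "length S = n"
    and "finite C"
    and "\<And>c x. c \<in> C \<Longrightarrow> x \<in> c \<Longrightarrow> c \<subseteq> closed_nbhd G x"
    and "\<And>v w. v \<in> verts G \<Longrightarrow> w \<in> closed_nbhd G v \<Longrightarrow> \<exists>c\<in>C. v \<in> c \<and> w \<in> c"
  shows "grundy_dom G = n"
proof (rule antisym)
  show "grundy_dom G \<le> n"
    using grundy_dom_attained legal_seq_length_le_clique_cover[OF assms(4-6)] assms(2) by metis
  show "n \<le> grundy_dom G"
    using length_le_grundy_dom[OF assms(1)] assms(3) by simp
qed

section \<open>The triangle with a path attached, where all three values occur\<close>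

definition triangle_path :: "(nat, nat \<times> nat) pre_digraph" where
  "triangle_path = \<lparr>verts = {0, 1, 2, 3, 4, 5},
     arcs = {(0,1), (1,0), (0,2), (2,0), (1,2), (2,1), (2,3), (3,2), (3,4), (4,3), (4,5), (5,4)},
     tail = fst, head = snd\<rparr>"

lemma verts_triangle_path: "verts triangle_path = {0, 1, 2, 3, 4, 5}"
  by (simp add: triangle_path_def)

lemma graph_triangle_path: "graph triangle_path"
proof -
  have "sym (arcs_ends triangle_path)"
    by (auto simp: triangle_path_def arcs_ends_def arc_to_ends_def sym_def)
  then show ?thesis
    by unfold_locales
      (auto simp: triangle_path_def symmetric_def arc_to_ends_def)
qed

lemma closed_nbhd_triangle_path:
  "closed_nbhd triangle_path 0 = {0, 1, 2}"
  "closed_nbhd triangle_path (Suc 0) = {0, 1, 2}"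
  "closed_nbhd triangle_path 2 = {0, 1, 2, 3}"
  "closed_nbhd triangle_path 3 = {2, 3, 4}"
  "closed_nbhd triangle_path 4 = {3, 4, 5}"
  "closed_nbhd triangle_path 5 = {4, 5}"
  by (auto simp: triangle_path_def closed_nbhd_def arcs_ends_def arc_to_ends_def)

lemma grundy_dom_triangle_path: "grundy_dom triangle_path = 4"
proof -
  interpret graph triangle_path
    by (rule graph_triangle_path)
  let ?C = "{{0, 1, 2}, {2, 3}, {3, 4}, {4, 5}} :: nat set set"
  \<comment> \<open>Running from the end of the path to the triangle, the entries 5, 4, 3, 2 newly
    dominate for instance 5, 3, 2, 0.\<close>
  have "legal_seq triangle_path (((([] @ [5]) @ [4]) @ [3]) @ [2])"
    unfolding legal_seq_snoc
    by (auto simp: verts_triangle_path closed_nbhd_triangle_path)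
  moreover have "card ?C = 4"
    by (simp add: set_eq_subset)
  ultimately show ?thesis
    by (rule grundy_dom_eqI)
      (auto simp: verts_triangle_path closed_nbhd_triangle_path)
qed

text \<open>Both losses occur in the sequence 5, 4, 3, 2: the entry 3 is deleted, and 4 newly
  dominated only 3. A triangle and a separate edge remain.\<close>

lemma grundy_dom_triangle_path_del_3: "grundy_dom (pre_digraph.del_vert triangle_path 3) = 2"
proof -
  interpret graph triangle_path
    by (rule graph_triangle_path)
  interpret del: fin_digraph "pre_digraph.del_vert triangle_path 3"
    by (rule fin_digraph_del_vert)
  let ?C = "{{0, 1, 2}, {4, 5}} :: nat set set"
  have "legal_seq (pre_digraph.del_vert triangle_path 3) (([] @ [5]) @ [2])"
    unfolding legal_seq_snoc
    by (auto simp: pre_digraph.verts_del_vert verts_triangle_path closed_nbhd_del_vert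
        closed_nbhd_triangle_path)
  moreover have "card ?C = 2"
    by (simp add: set_eq_subset)
  ultimately show ?thesis
    by (rule del.grundy_dom_eqI)
      (auto simp: pre_digraph.verts_del_vert verts_triangle_path closed_nbhd_del_vert
        closed_nbhd_triangle_path)
qed

text \<open>The path gets shorter by one edge, hence the cover by one clique, and only the entry 5
  is lost.\<close>

lemma grundy_dom_triangle_path_del_5: "grundy_dom (pre_digraph.del_vert triangle_path 5) = 3"
proof -
  interpret graph triangle_path
    by (rule graph_triangle_path)
  interpret del: fin_digraph "pre_digraph.del_vert triangle_path 5"
    by (rule fin_digraph_del_vert)
  let ?C = "{{0, 1, 2}, {2, 3}, {3, 4}} :: nat set set"
  have "legal_seq (pre_digraph.del_vert triangle_path 5) ((([] @ [4]) @ [3]) @ [2])"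
    unfolding legal_seq_snoc
    by (auto simp: pre_digraph.verts_del_vert verts_triangle_path closed_nbhd_del_vert
        closed_nbhd_triangle_path)
  moreover have "card ?C = 3"
    by (simp add: set_eq_subset)
  ultimately show ?thesis
    by (rule del.grundy_dom_eqI)
      (auto simp: pre_digraph.verts_del_vert verts_triangle_path closed_nbhd_del_vert
        closed_nbhd_triangle_path)
qed

text \<open>The vertices 0 and 1 have the same closed neighborhood, so deleting one costs nothing:
  the entry 2 still newly dominates 1.\<close>

lemma grundy_dom_triangle_path_del_0: "grundy_dom (pre_digraph.del_vert triangle_path 0) = 4"
proof -
  interpret graph triangle_path
    by (rule graph_triangle_path)
  interpret del: fin_digraph "pre_digraph.del_vert triangle_path 0"
    by (rule fin_digraph_del_vert)
  let ?C = "{{1, 2}, {2, 3}, {3, 4}, {4, 5}} :: nat set set"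
  have "legal_seq (pre_digraph.del_vert triangle_path 0) (((([] @ [5]) @ [4]) @ [3]) @ [2])"
    unfolding legal_seq_snoc
    by (auto simp: pre_digraph.verts_del_vert verts_triangle_path closed_nbhd_del_vert
        closed_nbhd_triangle_path)
  moreover have "card ?C = 4"
    by (simp add: set_eq_subset)
  ultimately show ?thesis
    by (rule del.grundy_dom_eqI)
      (auto simp: pre_digraph.verts_del_vert verts_triangle_path closed_nbhd_del_vert
        closed_nbhd_triangle_path)
qed

theorem theorem2p3:
  shows "(\<forall>(G :: ('a, 'b) pre_digraph) u. graph G \<and> u \<in> verts G \<longrightarrow>
            int (grundy_dom G) - 2 \<le> int (grundy_dom (pre_digraph.del_vert G u)) \<and>
            int (grundy_dom (pre_digraph.del_vert G u)) \<le> int (grundy_dom G))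
       \<and> (\<exists>(G :: (nat, nat \<times> nat) pre_digraph). graph G \<and>
            (\<exists>u\<^sub>2 \<in> verts G. \<exists>u\<^sub>1 \<in> verts G. \<exists>u\<^sub>0 \<in> verts G.
               distinct [u\<^sub>2, u\<^sub>1, u\<^sub>0] \<and>
               int (grundy_dom (pre_digraph.del_vert G u\<^sub>2)) = int (grundy_dom G) - 2 \<and>
               int (grundy_dom (pre_digraph.del_vert G u\<^sub>1)) = int (grundy_dom G) - 1 \<and>
               int (grundy_dom (pre_digraph.del_vert G u\<^sub>0)) = int (grundy_dom G)))"
proof (intro conjI allI impI)
  fix G :: "('a, 'b) pre_digraph" and u
  assume "graph G \<and> u \<in> verts G"
  then interpret graph G
    by simp
  show "int (grundy_dom G) - 2 \<le> int (grundy_dom (pre_digraph.del_vert G u))"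
    "int (grundy_dom (pre_digraph.del_vert G u)) \<le> int (grundy_dom G)"
    using grundy_dom_del_vert_bounds[of u] by simp_all
next
  show "\<exists>(G :: (nat, nat \<times> nat) pre_digraph). graph G \<and>
            (\<exists>u\<^sub>2 \<in> verts G. \<exists>u\<^sub>1 \<in> verts G. \<exists>u\<^sub>0 \<in> verts G.
               distinct [u\<^sub>2, u\<^sub>1, u\<^sub>0] \<and>
               int (grundy_dom (pre_digraph.del_vert G u\<^sub>2)) = int (grundy_dom G) - 2 \<and>
               int (grundy_dom (pre_digraph.del_vert G u\<^sub>1)) = int (grundy_dom G) - 1 \<and>
               int (grundy_dom (pre_digraph.del_vert G u\<^sub>0)) = int (grundy_dom G))"
    by (rule exI[of _ triangle_path], intro conjI graph_triangle_path,
        rule bexI[of _ 3], rule bexI[of _ 5], rule bexI[of _ 0])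
      (simp_all add: verts_triangle_path grundy_dom_triangle_path grundy_dom_triangle_path_del_3
        grundy_dom_triangle_path_del_5 grundy_dom_triangle_path_del_0)
qed

end
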